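(* Let $f_0$ be the map $$C^\infty(S^3,\mathrm{SU}(2))\ni x\mapsto(-\mathbf{1})^{\mathrm{D}(x)}x\in C^\infty(S^3,\mathrm{SU}(2)).$$ Then $f_0$ is a group isomorphism, and for each $v\in S^3$ the map $E_v\circ f_0: C^\infty(S^3,\mathrm{SU}(2))\to\mathrm{SU}(2)$, $x\mapsto f_0(x)(v)$, is a range decreasing group homomorphism; however, $E_v\circ f_0$ is not the evaluation at any point of $S^3$.
   Context: $\mathrm{SU}(2)$ is identified, as a manifold, with $S^3$ (via the unit quaternions). $C^\infty(S^3,\mathrm{SU}(2))$ is the group of $C^\infty$ maps $S^3\to\mathrm{SU}(2)$ under pointwise multiplication. $\mathrm{D}(x)\in\mathbb{Z}$ denotes the topological degree of $x\in C^\infty(S^3,\mathrm{SU}(2))$, viewed as a map $S^3\to S^3$. $\mathbf{1}$ is the identity matrix, and $-\mathbf{1}\in\mathrm{SU}(2)$ its negative. A map $f:C^\infty(S^3,\mathrm{SU}(2))\to\mathrm{SU}(2)$ is range decreasing if $f(x)\in x(S^3)$ for every $x$. The evaluation at $u\in S^3$ is the map $x\mapsto x(u)$. *)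

theory Defs
  imports "HOL-Analysis.Analysis" "HOL-Homology.Homology"
begin

section \<open>The group SU(2) and its identification with the 3-sphere\<close>

abbreviation S3 :: "(real^4) set" where
  "S3 \<equiv> sphere 0 1"

definition conj_transpose :: "complex^'n^'m \<Rightarrow> complex^'m^'n" where
  "conj_transpose A = (\<chi> i j. cnj (A $ j $ i))"

definition SU2 :: "(complex^2^2) monoid" where
  "SU2 = \<lparr>carrier = {A. A ** conj_transpose A = mat 1 \<and> conj_transpose A ** A = mat 1 \<and> det A = 1},
          mult = (**), one = mat 1\<rparr>"

(* The quaternion a + b i + c j + d k is written as alpha + beta j with alpha = a + b i, beta = c + d i. *)
definition quat_matrix :: "real^4 \<Rightarrow> complex^2^2" where
  "quat_matrix q =
     (let \<alpha> = Complex (q $ 1) (q $ 2); \<beta> = Complex (q $ 3) (q $ 4)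
      in vector [vector [\<alpha>, \<beta>], vector [- cnj \<beta>, cnj \<alpha>]])"

definition matrix_quat :: "complex^2^2 \<Rightarrow> real^4" where
  "matrix_quat A = vector [Re (A $ 1 $ 1), Im (A $ 1 $ 1), Re (A $ 1 $ 2), Im (A $ 1 $ 2)]"

lemma vec4_eq_iff: "(p :: 'a^4) = q \<longleftrightarrow> p $ 1 = q $ 1 \<and> p $ 2 = q $ 2 \<and> p $ 3 = q $ 3 \<and> p $ 4 = q $ 4"
  by (simp add: vec_eq_iff forall_4)

lemma mat2_eq_iff:
  "(A :: 'a^2^2) = B \<longleftrightarrow> A $ 1 $ 1 = B $ 1 $ 1 \<and> A $ 1 $ 2 = B $ 1 $ 2 \<and> A $ 2 $ 1 = B $ 2 $ 1 \<and> A $ 2 $ 2 = B $ 2 $ 2"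
  by (simp add: vec_eq_iff forall_2)

lemma vector4_nth [simp]:
  "(vector [a, b, c, d] :: ('a::zero)^4) $ 1 = a"
  "(vector [a, b, c, d] :: ('a::zero)^4) $ 2 = b"
  "(vector [a, b, c, d] :: ('a::zero)^4) $ 3 = c"
  "(vector [a, b, c, d] :: ('a::zero)^4) $ 4 = d"
  by (simp_all add: vector_def)

lemma norm4_eq_1_iff: "norm (q :: real^4) = 1 \<longleftrightarrow> (q $ 1)\<^sup>2 + (q $ 2)\<^sup>2 + (q $ 3)\<^sup>2 + (q $ 4)\<^sup>2 = 1"
  by (simp add: norm_vec_def L2_set_def sum_4)

lemma SU2_iff:
  "A \<in> carrier SU2 \<longleftrightarrow> A $ 2 $ 2 = cnj (A $ 1 $ 1) \<and> A $ 2 $ 1 = - cnj (A $ 1 $ 2) \<and>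
     (cmod (A $ 1 $ 1))\<^sup>2 + (cmod (A $ 1 $ 2))\<^sup>2 = 1" (is "?L \<longleftrightarrow> ?R")
proof
  define a b c d where "a = A $ 1 $ 1" and "b = A $ 1 $ 2" and "c = A $ 2 $ 1" and "d = A $ 2 $ 2"
  note abcd = a_def [symmetric] b_def [symmetric] c_def [symmetric] d_def [symmetric]
  {
    assume ?L
    then have eqs: "a * cnj a + b * cnj b = 1" "a * cnj c + b * cnj d = 0" "a * d - b * c = 1"
      by (simp_all add: SU2_def mat2_eq_iff matrix_matrix_mult_def conj_transpose_def sum_2 mat_def det_2 abcd)
    have "cnj d = cnj d * (a * d - b * c)" using eqs by simp
    also have "\<dots> = a * (d * cnj d + c * cnj c) - c * (a * cnj c + b * cnj d)" by (simp add: algebra_simps)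
    finally have 1: "cnj d = a * (d * cnj d + c * cnj c)" using eqs by simp
    have "- cnj c = - cnj c * (a * d - b * c)" using eqs by simp
    also have "\<dots> = b * (d * cnj d + c * cnj c) - d * (a * cnj c + b * cnj d)" by (simp add: algebra_simps)
    finally have 2: "- cnj c = b * (d * cnj d + c * cnj c)" using eqs by simp
    have 3: "d * cnj d + c * cnj c = 1"
      using \<open>?L\<close> by (simp add: SU2_def mat2_eq_iff matrix_matrix_mult_def conj_transpose_def sum_2 mat_def det_2 abcd add.commute)
    have "cnj d = a" "- cnj c = b"
      using 1 2 3 by simp_all
    then have "d = cnj a" "c = - cnj b"
      by auto
    moreover have "complex_of_real ((cmod a)\<^sup>2 + (cmod b)\<^sup>2) = of_real 1"
      using eqs(1) by (simp add: complex_norm_square del: of_real_power)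
    then have "(cmod a)\<^sup>2 + (cmod b)\<^sup>2 = 1"
      by (simp only: of_real_eq_iff)
    ultimately show ?R by (simp add: a_def b_def c_def d_def)
  next
    assume R: ?R
    then have cd: "d = cnj a" "c = - cnj b" by (simp_all add: a_def b_def c_def d_def)
    have "complex_of_real ((cmod a)\<^sup>2 + (cmod b)\<^sup>2) = 1"
      using R by (simp add: a_def b_def flip: of_real_add)
    then have "a * cnj a + b * cnj b = 1"
      by (simp add: complex_norm_square del: of_real_power)
    then show ?L
      by (simp add: SU2_def mat2_eq_iff matrix_matrix_mult_def conj_transpose_def sum_2 mat_def det_2 abcd cd
          algebra_simps)
  }
qed

lemma continuous_on_Complex [continuous_intros]:
  "continuous_on S f \<Longrightarrow> continuous_on S g \<Longrightarrow> continuous_on S (\<lambda>x. Complex (f x) (g x))"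
  unfolding complex_eq by (intro continuous_intros)

lemma homeomorphism_quat_matrix: "homeomorphism S3 (carrier SU2) quat_matrix matrix_quat"
proof (rule homeomorphismI)
  have "continuous_on S3 (\<lambda>q. quat_matrix q $ i $ j)" for i j
    using exhaust_2 [of i] exhaust_2 [of j]
    by (elim disjE; simp add: quat_matrix_def Let_def; intro continuous_intros)
  then have "continuous_on S3 (\<lambda>q. \<chi> i j. quat_matrix q $ i $ j)"
    by (intro continuous_on_vec_lambda)
  then show "continuous_on S3 quat_matrix" by simp
  have "continuous_on (carrier SU2) (\<lambda>A. matrix_quat A $ i)" for i
    using exhaust_4 [of i]
    by (elim disjE; simp add: matrix_quat_def; intro continuous_intros)
  then have "continuous_on (carrier SU2) (\<lambda>A. \<chi> i. matrix_quat A $ i)"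
    by (intro continuous_on_vec_lambda)
  then show "continuous_on (carrier SU2) matrix_quat" by simp
  show "quat_matrix ` S3 \<subseteq> carrier SU2"
    by (auto simp: norm4_eq_1_iff SU2_iff quat_matrix_def Let_def cmod_power2 add.assoc)
  show "matrix_quat ` carrier SU2 \<subseteq> S3"
    by (auto simp: norm4_eq_1_iff SU2_iff matrix_quat_def cmod_power2)
  show "matrix_quat (quat_matrix q) = q" if "q \<in> S3" for q
    by (simp add: vec4_eq_iff matrix_quat_def quat_matrix_def Let_def)
  show "quat_matrix (matrix_quat A) = A" if "A \<in> carrier SU2" for A
    using that by (simp add: SU2_iff mat2_eq_iff matrix_quat_def quat_matrix_def Let_def complex_eq_iff)
qed

lemma group_SU2: "group SU2"
proof (rule groupI)
  show "x \<otimes>\<^bsub>SU2\<^esub> y \<in> carrier SU2" if "x \<in> carrier SU2" "y \<in> carrier SU2" for x y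
  proof -
    have ct: "conj_transpose (x ** y) = conj_transpose y ** conj_transpose x"
      by (simp add: mat2_eq_iff conj_transpose_def matrix_matrix_mult_def sum_2 mult.commute)
    have "(x ** y) ** (conj_transpose y ** conj_transpose x) = x ** (y ** conj_transpose y) ** conj_transpose x"
      "(conj_transpose y ** conj_transpose x) ** (x ** y) = conj_transpose y ** (conj_transpose x ** x) ** y"
      by (simp_all add: matrix_mul_assoc)
    with that ct show ?thesis
      by (simp add: SU2_def det_mul)
  qed
  show "\<exists>y\<in>carrier SU2. y \<otimes>\<^bsub>SU2\<^esub> x = \<one>\<^bsub>SU2\<^esub>" if "x \<in> carrier SU2" for x
  proof
    show "conj_transpose x \<otimes>\<^bsub>SU2\<^esub> x = \<one>\<^bsub>SU2\<^esub>"
      using that by (simp add: SU2_def)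
    show "conj_transpose x \<in> carrier SU2"
      using that by (simp add: SU2_iff conj_transpose_def)
  qed
qed (simp_all add: SU2_def matrix_mul_assoc, simp add: conj_transpose_def mat2_eq_iff mat_def matrix_matrix_mult_def sum_2)

section \<open>Smooth maps\<close>

(* In finite-dimensional domains these are the classes C^k: all iterated directional derivatives exist
   as Frechet derivatives and are continuous. *)
fun C_k_on :: "nat \<Rightarrow> 'a::euclidean_space set \<Rightarrow> ('a \<Rightarrow> 'b::real_normed_vector) \<Rightarrow> bool" where
  "C_k_on 0 U f \<longleftrightarrow> continuous_on U f"
| "C_k_on (Suc k) U f \<longleftrightarrow>
     (\<forall>p\<in>U. f differentiable (at p)) \<and> (\<forall>v. C_k_on k U (\<lambda>p. frechet_derivative f (at p) v))"

(* Smoothness on an arbitrary subset: local extendability to C^infinity functions on open sets.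
   On an embedded submanifold this is smoothness with respect to the submanifold structure. *)
definition smooth_map_on :: "'a::euclidean_space set \<Rightarrow> ('a \<Rightarrow> 'b::real_normed_vector) \<Rightarrow> bool" where
  "smooth_map_on A f \<longleftrightarrow>
     (\<forall>p\<in>A. \<exists>U g. open U \<and> p \<in> U \<and> (\<forall>k. C_k_on k U g) \<and> (\<forall>q\<in>A \<inter> U. g q = f q))"

lemma C_k_on_const: "C_k_on k U (\<lambda>p. c)"
  by (induction k arbitrary: c) simp_all

lemma C_k_on_continuous: "C_k_on k U f \<Longrightarrow> continuous_on U f"
  by (cases k)
     (auto intro!: differentiable_imp_continuous_on simp: differentiable_on_def differentiable_at_withinI)

lemma C_k_on_SucD: "C_k_on (Suc k) U f \<Longrightarrow> C_k_on k U f"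
proof (induction k arbitrary: f)
  case 0
  then show ?case using C_k_on_continuous C_k_on.simps(1) by blast
qed auto

lemma C_k_on_subset: "C_k_on k U f \<Longrightarrow> V \<subseteq> U \<Longrightarrow> C_k_on k V f"
  by (induction k arbitrary: f) (auto intro: continuous_on_subset)

lemma C_k_on_cong:
  assumes "open U" "\<And>p. p \<in> U \<Longrightarrow> f p = g p"
  shows "C_k_on k U f \<longleftrightarrow> C_k_on k U g"
  using assms(2)
proof (induction k arbitrary: f g)
  case 0
  then show ?case by (simp cong: continuous_on_cong)
next
  case (Suc k)
  have D: "(f has_derivative f') (at p) \<longleftrightarrow> (g has_derivative f') (at p)" if "p \<in> U" for p f'
    using has_derivative_transform_within_open [OF _ assms(1) that, where f = f and g = g and f' = f']
      has_derivative_transform_within_open [OF _ assms(1) that, where f = g and g = f and f' = f'] Suc.prems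
    by metis
  then have "frechet_derivative f (at p) = frechet_derivative g (at p)" if "p \<in> U" for p
    using that by (simp add: frechet_derivative_def)
  then have "C_k_on k U (\<lambda>p. frechet_derivative f (at p) v) \<longleftrightarrow>
             C_k_on k U (\<lambda>p. frechet_derivative g (at p) v)" for v
    by (intro Suc.IH) simp
  then show ?case using D by (auto simp: differentiable_def)
qed

lemma C_k_on_SucI:
  assumes "open U" "\<And>p. p \<in> U \<Longrightarrow> (f has_derivative f' p) (at p)" "\<And>v. C_k_on k U (\<lambda>p. f' p v)"
  shows "C_k_on (Suc k) U f"
proof -
  have "frechet_derivative f (at p) = f' p" if "p \<in> U" for p
    using assms(2) that frechet_derivative_at by metis
  then have "C_k_on k U (\<lambda>p. frechet_derivative f (at p) v)" for v
    using assms(3) C_k_on_cong [OF assms(1), of "\<lambda>p. frechet_derivative f (at p) v" "\<lambda>p. f' p v"] by simp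
  then show ?thesis using assms(2) by (auto simp: differentiable_def)
qed

lemma C_k_on_SucE:
  assumes "C_k_on (Suc k) U f" "p \<in> U"
  shows "(f has_derivative frechet_derivative f (at p)) (at p)"
  using assms frechet_derivative_works by auto

lemma C_k_on_linear:
  assumes "bounded_linear L" "open U" "C_k_on k U f"
  shows "C_k_on k U (\<lambda>p. L (f p))"
  using assms(3)
proof (induction k arbitrary: f)
  case 0
  then show ?case using assms(1) by (simp add: bounded_linear.continuous_on)
next
  case (Suc k)
  show ?case
    by (rule C_k_on_SucI [OF assms(2), where f' = "\<lambda>p v. L (frechet_derivative f (at p) v)"])
       (use Suc in \<open>auto intro!: bounded_linear.has_derivative [OF assms(1)] C_k_on_SucE [OF Suc.prems]\<close>)
qed

lemma C_k_on_add:
  assumes "open U" "C_k_on k U f" "C_k_on k U g"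
  shows "C_k_on k U (\<lambda>p. f p + g p)"
  using assms(2,3)
proof (induction k arbitrary: f g)
  case 0
  then show ?case by (simp add: continuous_on_add)
next
  case (Suc k)
  show ?case
  proof (rule C_k_on_SucI [OF assms(1)])
    show "((\<lambda>p. f p + g p) has_derivative
        (\<lambda>v. frechet_derivative f (at p) v + frechet_derivative g (at p) v)) (at p)" if "p \<in> U" for p
      using that Suc.prems by (intro has_derivative_add C_k_on_SucE)
    show "C_k_on k U (\<lambda>p. frechet_derivative f (at p) v + frechet_derivative g (at p) v)" for v
      using Suc.prems by (intro Suc.IH) auto
  qed
qed

lemma C_k_on_bilinear:
  assumes "bounded_bilinear B" "open U" "C_k_on k U f" "C_k_on k U g"
  shows "C_k_on k U (\<lambda>p. B (f p) (g p))"
  using assms(3,4)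
proof (induction k arbitrary: f g)
  case 0
  then show ?case using assms(1) by (simp add: bounded_bilinear.continuous_on)
next
  case (Suc k)
  show ?case
  proof (rule C_k_on_SucI [OF assms(2)])
    show "((\<lambda>p. B (f p) (g p)) has_derivative
        (\<lambda>v. B (f p) (frechet_derivative g (at p) v) + B (frechet_derivative f (at p) v) (g p))) (at p)"
      if "p \<in> U" for p
      using that Suc.prems by (intro bounded_bilinear.FDERIV [OF assms(1)] C_k_on_SucE)
    show "C_k_on k U
        (\<lambda>p. B (f p) (frechet_derivative g (at p) v) + B (frechet_derivative f (at p) v) (g p))" for v
      using Suc.prems C_k_on_SucD [OF Suc.prems(1)] C_k_on_SucD [OF Suc.prems(2)]
      by (intro C_k_on_add [OF assms(2)] Suc.IH) auto
  qed
qed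

lemma smooth_map_on_linear:
  assumes "bounded_linear L" "smooth_map_on A f"
  shows "smooth_map_on A (\<lambda>p. L (f p))"
  unfolding smooth_map_on_def
proof
  fix p assume "p \<in> A"
  then obtain U g where "open U" "p \<in> U" "\<forall>k. C_k_on k U g" "\<forall>q\<in>A \<inter> U. g q = f q"
    using assms(2) unfolding smooth_map_on_def by meson
  then show "\<exists>U g. open U \<and> p \<in> U \<and> (\<forall>k. C_k_on k U g) \<and> (\<forall>q\<in>A \<inter> U. g q = L (f q))"
    by (intro exI [of _ U] exI [of _ "\<lambda>q. L (g q)"]) (auto intro: C_k_on_linear [OF assms(1)])
qed

lemma smooth_map_on_bilinear:
  assumes "bounded_bilinear B" "smooth_map_on A f" "smooth_map_on A g"
  shows "smooth_map_on A (\<lambda>p. B (f p) (g p))"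
  unfolding smooth_map_on_def
proof
  fix p assume "p \<in> A"
  then obtain U f' where U: "open U" "p \<in> U" "\<forall>k. C_k_on k U f'" "\<forall>q\<in>A \<inter> U. f' q = f q"
    using assms(2) unfolding smooth_map_on_def by meson
  obtain V g' where V: "open V" "p \<in> V" "\<forall>k. C_k_on k V g'" "\<forall>q\<in>A \<inter> V. g' q = g q"
    using \<open>p \<in> A\<close> assms(3) unfolding smooth_map_on_def by meson
  have "C_k_on k (U \<inter> V) (\<lambda>q. B (f' q) (g' q))" for k
    using U V by (intro C_k_on_bilinear [OF assms(1)]) (auto intro: C_k_on_subset)
  then show "\<exists>U h. open U \<and> p \<in> U \<and> (\<forall>k. C_k_on k U h) \<and> (\<forall>q\<in>A \<inter> U. h q = B (f q) (g q))"
    using U V by (intro exI [of _ "U \<inter> V"] exI [of _ "\<lambda>q. B (f' q) (g' q)"]) auto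
qed

lemma smooth_map_on_cong: "(\<And>p. p \<in> A \<Longrightarrow> f p = g p) \<Longrightarrow> smooth_map_on A f \<longleftrightarrow> smooth_map_on A g"
  unfolding smooth_map_on_def by (metis (no_types, lifting) IntD1)

lemma smooth_map_on_const: "smooth_map_on A (\<lambda>p. c)"
  unfolding smooth_map_on_def using C_k_on_const [of _ UNIV c]
  by (intro ballI exI [of _ UNIV] exI [of _ "\<lambda>p. c"]) auto

lemma bounded_bilinear_matrix_mult:
  "bounded_bilinear ((**) :: complex^2^2 \<Rightarrow> complex^2^2 \<Rightarrow> complex^2^2)"
  unfolding bilinear_conv_bounded_bilinear [symmetric] bilinear_def
  by (auto intro!: linearI simp: mat2_eq_iff matrix_matrix_mult_def sum_2 algebra_simps)

lemma bounded_linear_conj_transpose: "bounded_linear (conj_transpose :: complex^2^2 \<Rightarrow> complex^2^2)"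
  unfolding linear_conv_bounded_linear [symmetric]
  by (auto intro!: linearI simp: mat2_eq_iff conj_transpose_def)

section \<open>The group of smooth maps into SU(2)\<close>

(* SU(2) is an embedded submanifold of the space of complex 2x2 matrices, so smoothness into SU(2)
   is smoothness as a matrix-valued map.  Maps are normalised to be undefined outside S3. *)
definition smooth_SU2 :: "(real^4 \<Rightarrow> complex^2^2) monoid" where
  "smooth_SU2 =
     \<lparr>carrier = {x \<in> S3 \<rightarrow>\<^sub>E carrier SU2. smooth_map_on S3 x},
      mult = (\<lambda>x y. \<lambda>u\<in>S3. x u \<otimes>\<^bsub>SU2\<^esub> y u),
      one = (\<lambda>u\<in>S3. \<one>\<^bsub>SU2\<^esub>)\<rparr>"

lemma group_smooth_SU2: "group smooth_SU2"
proof (rule groupI)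
  interpret SU2: group SU2 by (rule group_SU2)
  have mult: "(\<otimes>\<^bsub>SU2\<^esub>) = (**)" by (simp add: SU2_def)
  show "x \<otimes>\<^bsub>smooth_SU2\<^esub> y \<in> carrier smooth_SU2"
    if "x \<in> carrier smooth_SU2" "y \<in> carrier smooth_SU2" for x y
  proof -
    have "smooth_map_on S3 (\<lambda>u. x u ** y u)"
      using that by (intro smooth_map_on_bilinear [OF bounded_bilinear_matrix_mult]) (auto simp: smooth_SU2_def)
    then have "smooth_map_on S3 (\<lambda>u\<in>S3. x u \<otimes>\<^bsub>SU2\<^esub> y u)"
      by (subst smooth_map_on_cong [where g = "\<lambda>u. x u ** y u"]) (auto simp: mult)
    then show ?thesis
      using that by (auto simp: smooth_SU2_def PiE_iff)
  qed
  have "smooth_map_on S3 (\<lambda>u\<in>S3. \<one>\<^bsub>SU2\<^esub>)"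
    by (subst smooth_map_on_cong [where g = "\<lambda>u. \<one>\<^bsub>SU2\<^esub>"]) (auto simp: smooth_map_on_const)
  then show "\<one>\<^bsub>smooth_SU2\<^esub> \<in> carrier smooth_SU2"
    by (auto simp: smooth_SU2_def)
  show "x \<otimes>\<^bsub>smooth_SU2\<^esub> y \<otimes>\<^bsub>smooth_SU2\<^esub> z = x \<otimes>\<^bsub>smooth_SU2\<^esub> (y \<otimes>\<^bsub>smooth_SU2\<^esub> z)"
    if "x \<in> carrier smooth_SU2" "y \<in> carrier smooth_SU2" "z \<in> carrier smooth_SU2" for x y z
    using that by (auto simp: smooth_SU2_def PiE_iff SU2.m_assoc intro!: restrict_ext)
  show "\<one>\<^bsub>smooth_SU2\<^esub> \<otimes>\<^bsub>smooth_SU2\<^esub> x = x" if "x \<in> carrier smooth_SU2" for x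
    using that by (auto simp: smooth_SU2_def PiE_iff extensional_def fun_eq_iff restrict_def)
  show "\<exists>y\<in>carrier smooth_SU2. y \<otimes>\<^bsub>smooth_SU2\<^esub> x = \<one>\<^bsub>smooth_SU2\<^esub>" if x: "x \<in> carrier smooth_SU2" for x
  proof
    have ct: "conj_transpose A \<otimes>\<^bsub>SU2\<^esub> A = \<one>\<^bsub>SU2\<^esub>" "conj_transpose A \<in> carrier SU2" if "A \<in> carrier SU2" for A
      using that by (simp add: SU2_def, simp add: SU2_iff conj_transpose_def)
    have "smooth_map_on S3 (\<lambda>u. conj_transpose (x u))"
      using x by (intro smooth_map_on_linear [OF bounded_linear_conj_transpose]) (auto simp: smooth_SU2_def)
    then have "smooth_map_on S3 (\<lambda>u\<in>S3. conj_transpose (x u))"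
      by (subst smooth_map_on_cong [where g = "\<lambda>u. conj_transpose (x u)"]) auto
    then show "(\<lambda>u\<in>S3. conj_transpose (x u)) \<in> carrier smooth_SU2"
      using x ct(2) by (auto simp: smooth_SU2_def PiE_iff)
    show "(\<lambda>u\<in>S3. conj_transpose (x u)) \<otimes>\<^bsub>smooth_SU2\<^esub> x = \<one>\<^bsub>smooth_SU2\<^esub>"
      using x ct(1) by (auto simp: smooth_SU2_def PiE_iff intro!: restrict_ext)
  qed
qed

section \<open>Degree\<close>

(* The library's standard 3-sphere consists of sequences supported on the indices 0,...,3. *)
definition to_nsphere :: "real^4 \<Rightarrow> nat \<Rightarrow> real" where
  "to_nsphere q = (\<lambda>i. if i < 4 then [q $ 1, q $ 2, q $ 3, q $ 4] ! i else 0)"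

definition of_nsphere :: "(nat \<Rightarrow> real) \<Rightarrow> real^4" where
  "of_nsphere c = vector [c 0, c 1, c 2, c 3]"

lemma homeomorphic_maps_nsphere:
  "homeomorphic_maps (top_of_set S3) (nsphere 3) to_nsphere of_nsphere"
proof -
  have sum3: "(\<Sum>i\<le>3. f i) = f 0 + f 1 + f 2 + f 3" for f :: "nat \<Rightarrow> real"
    by (simp add: numeral_3_eq_3 numeral_2_eq_2)
  have "continuous_map (top_of_set S3) euclideanreal (\<lambda>q. to_nsphere q i)" for i
  proof -
    consider "i = 0" | "i = 1" | "i = 2" | "i = 3" | "i \<ge> 4" by linarith
    then show ?thesis
      by cases (auto simp: to_nsphere_def intro!: continuous_intros)
  qed
  then have "continuous_map (top_of_set S3) (powertop_real UNIV) to_nsphere"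
    by (simp add: continuous_map_componentwise_UNIV)
  moreover have "to_nsphere q \<in> {x. (\<Sum>i\<le>3. (x i)\<^sup>2) = 1 \<and> (\<forall>i>3. x i = 0)}" if "q \<in> S3" for q
    using that by (simp add: norm4_eq_1_iff sum3 to_nsphere_def numeral_3_eq_3)
  ultimately have 1: "continuous_map (top_of_set S3) (nsphere 3) to_nsphere"
    by (auto simp: nsphere continuous_map_in_subtopology)
  have "continuous_map (nsphere 3) euclideanreal (\<lambda>c. of_nsphere c $ i)" for i
    using exhaust_4 [of i] continuous_map_nsphere_projection
    by (elim disjE) (simp_all add: of_nsphere_def)
  then have "continuous_map (nsphere 3) euclidean (\<lambda>c. \<chi> i. of_nsphere c $ i)"
    unfolding continuous_map_atin limitin_canonical_iff by (auto intro!: vec_tendstoI)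
  moreover have "of_nsphere c \<in> S3" if "c \<in> topspace (nsphere 3)" for c
    using that by (simp add: norm4_eq_1_iff sum3 of_nsphere_def nsphere)
  ultimately have 2: "continuous_map (nsphere 3) (top_of_set S3) of_nsphere"
    by (auto simp: continuous_map_in_subtopology)
  have "of_nsphere (to_nsphere q) = q" for q
    by (simp add: vec4_eq_iff of_nsphere_def to_nsphere_def numeral_3_eq_3)
  moreover have "to_nsphere (of_nsphere c) = c" if "c \<in> topspace (nsphere 3)" for c
  proof
    fix i :: nat
    consider "i = 0" | "i = 1" | "i = 2" | "i = 3" | "i \<ge> 4" by linarith
    then show "to_nsphere (of_nsphere c) i = c i"
      by cases (use that in \<open>auto simp: of_nsphere_def to_nsphere_def nsphere\<close>)
  qed
  ultimately show ?thesis using 1 2 by (simp add: homeomorphic_maps_def)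
qed

(* The degree of x viewed as a self-map of the 3-sphere: source and target carry the same
   identification, so the orientation of the sphere does not matter. *)
definition degree_SU2 :: "(real^4 \<Rightarrow> complex^2^2) \<Rightarrow> int" where
  "degree_SU2 x = Brouwer_degree2 3 (to_nsphere \<circ> matrix_quat \<circ> x \<circ> of_nsphere)"

section \<open>Maps from smooth maps to SU(2)\<close>

definition range_decreasing :: "((real^4 \<Rightarrow> complex^2^2) \<Rightarrow> complex^2^2) \<Rightarrow> bool" where
  "range_decreasing f \<longleftrightarrow> (\<forall>x\<in>carrier smooth_SU2. f x \<in> x ` S3)"

definition evaluation :: "real^4 \<Rightarrow> (real^4 \<Rightarrow> complex^2^2) \<Rightarrow> complex^2^2" where
  "evaluation u x = x u"

definition f0 :: "(real^4 \<Rightarrow> complex^2^2) \<Rightarrow> (real^4 \<Rightarrow> complex^2^2)" where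
  "f0 x = (\<lambda>u\<in>S3. ((- mat 1) [^]\<^bsub>SU2\<^esub> degree_SU2 x) \<otimes>\<^bsub>SU2\<^esub> x u)"

end

(* The degree turns pointwise products into sums, so f0 is a homomorphism; as - x has the same degree
   as x, it is an involution.  A map x of odd degree is surjective and hence takes the value - x v.
   If f0 followed by evaluation at v were evaluation at u, then the identity (of degree 1) would
   force u = - v, while the non-surjective map q |-> exp (i (q . v)) has degree 0 and separates
   v from - v.

   For the additivity of the degree, let f1, f2, g1, g2 be self-maps of a sphere such that, on each of
   two open sets covering it, {f1, f2} and {g1, g2} agree up to order.  A fundamental cycle can
   be subdivided until each of its simplices lies in one of these sets; hence
   deg f1 + deg f2 = deg g1 + deg g2. *)
theory Submission
  imports Defs
begin

section \<open>Homology under pairs of maps that agree up to order on an open cover\<close>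

text \<open>The sum of two pushforwards does not see the order of the maps: on a simplex in
  \<open>U\<close> the terms match directly, on one in \<open>V\<close> after a swap. Linearity in
  the coefficients extends this to \<open>c\<close>.\<close>

lemma chain_map_add_eq_if_small:
  assumes c: "\<And>\<sigma>. \<sigma> \<in> Poly_Mapping.keys c \<Longrightarrow> \<sigma> \<in> standard_simplex p \<rightarrow> U \<or> \<sigma> \<in> standard_simplex p \<rightarrow> V"
    and U: "\<And>x. x \<in> U \<Longrightarrow> f1 x = g1 x \<and> f2 x = g2 x"
    and V: "\<And>x. x \<in> V \<Longrightarrow> f1 x = g2 x \<and> f2 x = g1 x"
  shows "chain_map p f1 c + chain_map p f2 c = chain_map p g1 c + chain_map p g2 c"
proof -
  have "frag_of (simplex_map p f1 \<sigma>) + frag_of (simplex_map p f2 \<sigma>)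
      = frag_of (simplex_map p g1 \<sigma>) + frag_of (simplex_map p g2 \<sigma>)"
    if "\<sigma> \<in> Poly_Mapping.keys c" for \<sigma>
    using c [OF that]
  proof
    assume "\<sigma> \<in> standard_simplex p \<rightarrow> U"
    then have "simplex_map p f1 \<sigma> = simplex_map p g1 \<sigma>" "simplex_map p f2 \<sigma> = simplex_map p g2 \<sigma>"
      using U by (auto simp: simplex_map_def Pi_iff intro!: restrict_ext)
    then show ?thesis by simp
  next
    assume "\<sigma> \<in> standard_simplex p \<rightarrow> V"
    then have "simplex_map p f1 \<sigma> = simplex_map p g2 \<sigma>" "simplex_map p f2 \<sigma> = simplex_map p g1 \<sigma>"
      using V by (auto simp: simplex_map_def Pi_iff intro!: restrict_ext)
    then show ?thesis by simp
  qed
  then show ?thesis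
    unfolding chain_map_def frag_extend_def
    by (auto simp: sum.distrib [symmetric] frag_cmul_distrib2 [symmetric] intro!: sum.cong)
qed

text \<open>The class \<open>a\<close> has a representing cycle whose simplices each lie in
  \<open>U\<close> or \<open>V\<close>, and for such a cycle the identity already holds on chains.
  Homology groups are written multiplicatively, so products of classes stand for sums of
  cycles.\<close>

lemma hom_induced_mult_eq_if_cover:
  assumes cont: "continuous_map X Y f1" "continuous_map X Y f2" "continuous_map X Y g1" "continuous_map X Y g2"
    and "openin X U" "openin X V" "topspace X \<subseteq> U \<union> V"
    and U: "\<And>x. x \<in> U \<Longrightarrow> f1 x = g1 x \<and> f2 x = g2 x"
    and V: "\<And>x. x \<in> V \<Longrightarrow> f1 x = g2 x \<and> f2 x = g1 x"
    and a: "a \<in> carrier (homology_group (int p) X)"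
  shows "hom_induced p X {} Y {} f1 a \<otimes>\<^bsub>homology_group (int p) Y\<^esub> hom_induced p X {} Y {} f2 a
       = hom_induced p X {} Y {} g1 a \<otimes>\<^bsub>homology_group (int p) Y\<^esub> hom_induced p X {} Y {} g2 a"
proof -
  obtain b where b: "singular_relcycle p X {} b" "a = homologous_rel_set p X {} b"
    using a by (auto simp: carrier_relative_homology_group)
  \<comment> \<open>Iterated subdivision gives a homologous cycle subordinate to the cover.\<close>
  obtain c where c: "singular_relcycle p X {} c" "homologous_rel p X {} b c"
    "\<And>\<sigma>. \<sigma> \<in> Poly_Mapping.keys c \<Longrightarrow> \<exists>W \<in> {U, V}. \<sigma> \<in> standard_simplex p \<rightarrow> W"
    using small_homologous_rel_relcycle_exists [of "{U, V}" X p "{}" b] assms b(1) by auto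
  have ac: "a = homologous_rel_set p X {} c"
    using b(2) c(2) by (simp add: homologous_rel_set_eq)
  have hom: "hom_induced p X {} Y {} f a = homologous_rel_set p Y {} (chain_map p f c)"
    if "continuous_map X Y f" for f
    unfolding ac by (rule hom_induced_chain_map [OF that _ c(1)]) auto
  \<comment> \<open>Classes are multiplied elementwise as sets of chains; a chain \<open>w\<close>
    homologous to \<open>s + t\<close> is split as \<open>s + (w - s)\<close>.\<close>
  have mult: "homologous_rel_set p Y {} s \<otimes>\<^bsub>homology_group (int p) Y\<^esub> homologous_rel_set p Y {} t
      = homologous_rel_set p Y {} (s + t)" for s t
  proof (intro equalityI subsetI)
    fix w assume "w \<in> homologous_rel_set p Y {} s \<otimes>\<^bsub>homology_group (int p) Y\<^esub> homologous_rel_set p Y {} t"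
    then show "w \<in> homologous_rel_set p Y {} (s + t)"
      by (auto simp: mult_relative_homology_group homologous_rel_add)
  next
    fix w assume w: "w \<in> homologous_rel_set p Y {} (s + t)"
    then have "homologous_rel p Y {} t (w - s)"
      by (simp add: homologous_rel_def algebra_simps)
    then show "w \<in> homologous_rel_set p Y {} s \<otimes>\<^bsub>homology_group (int p) Y\<^esub> homologous_rel_set p Y {} t"
      by (force simp: mult_relative_homology_group intro: bexI [of _ s] bexI [of _ "w - s"])
  qed
  have "chain_map p f1 c + chain_map p f2 c = chain_map p g1 c + chain_map p g2 c"
    using c(3) by (intro chain_map_add_eq_if_small [OF _ U V]) auto
  then show ?thesis
    by (simp add: hom cont mult)
qed

text \<open>Each self-map raises a generator of the infinite cyclic reduced homology group to the
  power of its degree, so the product identity for induced maps becomes an identity of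
  exponents.\<close>

lemma Brouwer_degree2_add_eq_if_cover:
  assumes cont: "continuous_map (nsphere p) (nsphere p) f1" "continuous_map (nsphere p) (nsphere p) f2"
      "continuous_map (nsphere p) (nsphere p) g1" "continuous_map (nsphere p) (nsphere p) g2"
    and cover: "openin (nsphere p) U" "openin (nsphere p) V" "topspace (nsphere p) \<subseteq> U \<union> V"
    and U: "\<And>x. x \<in> U \<Longrightarrow> f1 x = g1 x \<and> f2 x = g2 x"
    and V: "\<And>x. x \<in> V \<Longrightarrow> f1 x = g2 x \<and> f2 x = g1 x"
  shows "Brouwer_degree2 p f1 + Brouwer_degree2 p f2 = Brouwer_degree2 p g1 + Brouwer_degree2 p g2"
proof -
  let ?G = "reduced_homology_group (int p) (nsphere p)"
  interpret group ?G
    by simp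
  obtain a where a: "a \<in> carrier ?G" and aeq: "subgroup_generated ?G {a} = ?G"
    using cyclic_reduced_homology_group_nsphere [of p p] by (auto simp: cyclic_group_def)
  \<comment> \<open>Order 0 encodes infinite order; this is what allows exponents to be
    compared.\<close>
  have ord: "ord a = 0"
    by (simp add: a aeq iso_finite [OF reduced_homology_group_nsphere(1)] flip: infinite_cyclic_subgroup_order)
  \<comment> \<open>The reduced group is a subgroup of the full one with the same operation, so the
    identity for full homology applies to its generator.\<close>
  have mult: "(\<otimes>\<^bsub>homology_group (int p) (nsphere p)\<^esub>) = (\<otimes>\<^bsub>?G\<^esub>)"
    by (simp add: reduced_homology_group_def subgroup_generated_def)
  have "a \<in> carrier (homology_group (int p) (nsphere p))"
    using a carrier_reduced_homology_group_subset by blast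
  from hom_induced_mult_eq_if_cover [OF cont cover U V this]
  have "a [^]\<^bsub>?G\<^esub> (Brouwer_degree2 p f1 + Brouwer_degree2 p f2)
      = a [^]\<^bsub>?G\<^esub> (Brouwer_degree2 p g1 + Brouwer_degree2 p g2)"
    by (simp add: mult Brouwer_degree2 a int_pow_mult)
  then show ?thesis
    using a ord by (simp add: int_pow_eq)
qed

section \<open>Deforming the identity of a sphere to be constant on a large cap\<close>

text \<open>The straight-line homotopy misses 0 and can therefore be projected radially;
  \<open>sgn\<close> divides by the norm.\<close>

lemma homotopic_normalized:
  fixes f g :: "'a::topological_space \<Rightarrow> 'b::real_normed_vector"
  assumes "continuous_on S f" "continuous_on S g"
    and seg: "\<And>x. x \<in> S \<Longrightarrow> 0 \<notin> closed_segment (f x) (g x)"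
  shows "homotopic_with_canon (\<lambda>_. True) S (sphere 0 1) (\<lambda>x. sgn (f x)) (\<lambda>x. sgn (g x))"
proof -
  have "homotopic_with_canon (\<lambda>_. True) S (- {0}) f g"
    using assms by (intro homotopic_with_linear) auto
  moreover have "continuous_on (- {0}) (sgn :: 'b \<Rightarrow> 'b)"
    by (intro continuous_intros) auto
  moreover have "sgn \<in> (- {0::'b}) \<rightarrow> sphere 0 1"
    by (auto simp: norm_sgn)
  ultimately have "homotopic_with_canon (\<lambda>_. True) S (sphere 0 1) (sgn \<circ> f) (sgn \<circ> g)"
    by (rule homotopic_with_compose_continuous_left)
  then show ?thesis
    by (simp add: o_def)
qed

text \<open>Composing with \<open>\<phi>\<close> makes any map on the sphere constant on a cap
  slightly larger than a hemisphere, within its homotopy class. The interiors of the caps for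
  \<open>e\<close> and \<open>- e\<close> cover the sphere.\<close>

lemma sphere_collapse:
  fixes e :: "'a::real_inner"
  assumes e: "e \<in> sphere 0 1"
  obtains \<phi> where "homotopic_with_canon (\<lambda>_. True) (sphere 0 1) (sphere 0 1) \<phi> id"
    "\<And>q. q \<bullet> e \<le> 1/4 \<Longrightarrow> \<phi> q = - e"
proof
  \<comment> \<open>The coefficient of \<open>q\<close> vanishes on the cap, leaving
    \<open>- e\<close> there, and grows to 3 at \<open>q = e\<close>. Truncation by
    \<open>max\<close> keeps it continuous.\<close>
  define \<phi> where "\<phi> q = sgn ((4 * max 0 (q \<bullet> e - 1/4)) *\<^sub>R q - e)" for q :: 'a
  \<comment> \<open>A zero on the segment gives \<open>(1 - t) e = s q\<close>; comparing norms
    yields \<open>s = 1 - t\<close>, hence \<open>q = e\<close> unless \<open>t = 1\<close>. Both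
    cases contradict the formula for \<open>s\<close>.\<close>
  have seg: "0 \<notin> closed_segment ((4 * max 0 (q \<bullet> e - 1/4)) *\<^sub>R q - e) q" if q: "q \<in> sphere 0 1" for q
  proof
    assume "0 \<in> closed_segment ((4 * max 0 (q \<bullet> e - 1/4)) *\<^sub>R q - e) q"
    then obtain t where t: "0 \<le> t" "t \<le> 1"
      and 0: "0 = (1 - t) *\<^sub>R ((4 * max 0 (q \<bullet> e - 1/4)) *\<^sub>R q - e) + t *\<^sub>R q"
      by (auto simp: in_segment)
    define s where "s = (1 - t) * (4 * max 0 (q \<bullet> e - 1/4)) + t"
    have sq: "(1 - t) *\<^sub>R e = s *\<^sub>R q"
      using 0 by (simp add: s_def algebra_simps)
    have s0: "s \<ge> 0"
      using t by (simp add: s_def)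
    have "norm ((1 - t) *\<^sub>R e) = norm (s *\<^sub>R q)"
      by (simp only: sq)
    then have s: "s = 1 - t"
      using e q t s0 by simp
    show False
    proof (cases "t = 1")
      case True
      then show False using s s_def by simp
    next
      case False
      then have "e = q"
        using sq s by simp
      then have "q \<bullet> e = 1"
        using q by (simp add: dot_square_norm)
      \<comment> \<open>At \<open>q = e\<close> the coefficient is \<open>4 * (1 - 1/4) = 3\<close>;
        with \<open>s = 1 - t\<close> this would need \<open>t = 2\<close>.\<close>
      then have "s = (1 - t) * 3 + t"
        by (simp add: s_def)
      then show False
        using s t False by simp
    qed
  qed
  have "homotopic_with_canon (\<lambda>_. True) (sphere 0 1) (sphere 0 1) \<phi> (\<lambda>q. sgn q)"
    unfolding \<phi>_def using seg by (intro homotopic_normalized continuous_intros) auto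
  then show "homotopic_with_canon (\<lambda>_. True) (sphere 0 1) (sphere 0 1) \<phi> id"
    by (rule homotopic_with_eq) (auto simp: sgn_div_norm)
  show "\<phi> q = - e" if "q \<bullet> e \<le> 1/4" for q
  proof -
    have "max 0 (q \<bullet> e - 1/4) = 0"
      using that by simp
    then show ?thesis
      using e by (simp add: \<phi>_def sgn_div_norm)
  qed
qed

section \<open>Degree of maps from the 3-sphere to SU(2)\<close>

lemma nsphere_maps:
  shows "continuous_map (top_of_set S3) (nsphere 3) to_nsphere"
    and "continuous_map (nsphere 3) (top_of_set S3) of_nsphere"
    and "c \<in> topspace (nsphere 3) \<Longrightarrow> of_nsphere c \<in> S3"
    and "q \<in> S3 \<Longrightarrow> to_nsphere q \<in> topspace (nsphere 3)"
    and "q \<in> S3 \<Longrightarrow> of_nsphere (to_nsphere q) = q"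
    and "c \<in> topspace (nsphere 3) \<Longrightarrow> to_nsphere (of_nsphere c) = c"
  using homeomorphic_maps_nsphere
  by (auto simp: homeomorphic_maps_def continuous_map_def Pi_iff)

lemma continuous_map_SU2_nsphere:
  "continuous_map (top_of_set (carrier SU2)) (nsphere 3) (to_nsphere \<circ> matrix_quat)"
  using homeomorphism_quat_matrix nsphere_maps(1)
  by (intro continuous_map_compose [of _ "top_of_set S3"]) (auto simp: homeomorphism_def)

lemma continuous_map_conjugate:
  assumes "continuous_on S3 x" "x \<in> S3 \<rightarrow> carrier SU2"
  shows "continuous_map (nsphere 3) (nsphere 3) (to_nsphere \<circ> matrix_quat \<circ> x \<circ> of_nsphere)"
proof -
  have "continuous_map (top_of_set S3) (top_of_set (carrier SU2)) x"
    using assms by simp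
  then show ?thesis
    using continuous_map_SU2_nsphere nsphere_maps(2) by (metis continuous_map_compose)
qed

lemma degree_SU2_homotopic:
  assumes "homotopic_with_canon (\<lambda>_. True) S3 (carrier SU2) x y"
  shows "degree_SU2 x = degree_SU2 y"
  unfolding degree_SU2_def
proof (rule Brouwer_degree2_homotopic)
  have "homotopic_with (\<lambda>_. True) (nsphere 3) (nsphere 3)
      ((to_nsphere \<circ> matrix_quat) \<circ> (x \<circ> of_nsphere)) ((to_nsphere \<circ> matrix_quat) \<circ> (y \<circ> of_nsphere))"
    by (rule homotopic_with_compose_continuous_map_left
        [OF homotopic_with_compose_continuous_map_right [OF assms nsphere_maps(2)] continuous_map_SU2_nsphere]) auto
  then show "homotopic_with (\<lambda>_. True) (nsphere 3) (nsphere 3)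
      (to_nsphere \<circ> matrix_quat \<circ> x \<circ> of_nsphere) (to_nsphere \<circ> matrix_quat \<circ> y \<circ> of_nsphere)"
    by (simp add: o_assoc)
qed

lemma degree_SU2_cong:
  assumes "\<And>u. u \<in> S3 \<Longrightarrow> x u = y u"
  shows "degree_SU2 x = degree_SU2 y"
  unfolding degree_SU2_def using assms nsphere_maps(3) by (intro Brouwer_degree2_eq) simp

lemma degree_SU2_const: "degree_SU2 (\<lambda>_. A) = 0"
proof -
  have "to_nsphere \<circ> matrix_quat \<circ> (\<lambda>_. A) \<circ> of_nsphere = (\<lambda>_. to_nsphere (matrix_quat A))"
    by auto
  then show ?thesis
    unfolding degree_SU2_def by (simp only: Brouwer_degree2_const)
qed

text \<open>Under the identification of SU(2) with the sphere, \<open>quat_matrix\<close> is the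
  identity map.\<close>

lemma degree_SU2_quat_matrix: "degree_SU2 quat_matrix = 1"
proof -
  have "Brouwer_degree2 3 (to_nsphere \<circ> matrix_quat \<circ> quat_matrix \<circ> of_nsphere) = Brouwer_degree2 3 id"
    using homeomorphism_quat_matrix nsphere_maps
    by (intro Brouwer_degree2_eq) (auto simp: homeomorphism_def)
  then show ?thesis
    by (simp add: degree_SU2_def)
qed

text \<open>A missed matrix \<open>A\<close> corresponds to a missed point of the sphere. This
  serves two ends: nonzero degree yields surjectivity, and a small image yields degree 0.\<close>

lemma degree_SU2_eq_0_if_not_surj:
  assumes "continuous_on S3 x" "x \<in> S3 \<rightarrow> carrier SU2" "A \<in> carrier SU2" "A \<notin> x ` S3"
  shows "degree_SU2 x = 0"
  unfolding degree_SU2_def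
proof (rule Brouwer_degree2_nonsurjective)
  show "continuous_map (nsphere 3) (nsphere 3) (to_nsphere \<circ> matrix_quat \<circ> x \<circ> of_nsphere)"
    by (rule continuous_map_conjugate) fact+
  have mq: "matrix_quat A \<in> S3"
    using assms(3) homeomorphism_quat_matrix by (auto simp: homeomorphism_def)
  have "to_nsphere (matrix_quat A) \<noteq> (to_nsphere \<circ> matrix_quat \<circ> x \<circ> of_nsphere) c"
    if c: "c \<in> topspace (nsphere 3)" for c
  proof
    assume eq: "to_nsphere (matrix_quat A) = (to_nsphere \<circ> matrix_quat \<circ> x \<circ> of_nsphere) c"
    have u: "of_nsphere c \<in> S3" by (rule nsphere_maps(3) [OF c])
    then have xu: "x (of_nsphere c) \<in> carrier SU2" using assms(2) by auto
    then have "matrix_quat (x (of_nsphere c)) \<in> S3"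
      using homeomorphism_quat_matrix by (auto simp: homeomorphism_def)
    then have "matrix_quat A = matrix_quat (x (of_nsphere c))"
      using arg_cong [OF eq, of of_nsphere] mq nsphere_maps(5) by simp
    then have "A = x (of_nsphere c)"
      using homeomorphism_quat_matrix assms(3) xu by (metis homeomorphism_def)
    then show False using u assms(4) by blast
  qed
  then show "(to_nsphere \<circ> matrix_quat \<circ> x \<circ> of_nsphere) ` topspace (nsphere 3) \<noteq> topspace (nsphere 3)"
    using nsphere_maps(4) [OF mq] by blast
qed

text \<open>The cover is given in the ambient space; intersected with the sphere and pulled back
  along \<open>of_nsphere\<close>, it becomes an open cover of \<open>nsphere 3\<close>.\<close>

lemma degree_SU2_add_eq_if_cover:
  assumes cont: "\<And>f. f \<in> {f1, f2, g1, g2} \<Longrightarrow> continuous_on S3 f \<and> f \<in> S3 \<rightarrow> carrier SU2"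
    and "open U" "open V" "S3 \<subseteq> U \<union> V"
    and U: "\<And>u. u \<in> U \<Longrightarrow> f1 u = g1 u \<and> f2 u = g2 u"
    and V: "\<And>u. u \<in> V \<Longrightarrow> f1 u = g2 u \<and> f2 u = g1 u"
  shows "degree_SU2 f1 + degree_SU2 f2 = degree_SU2 g1 + degree_SU2 g2"
  unfolding degree_SU2_def
proof (rule Brouwer_degree2_add_eq_if_cover)
  show "openin (nsphere 3) {c \<in> topspace (nsphere 3). of_nsphere c \<in> S3 \<inter> U}"
    "openin (nsphere 3) {c \<in> topspace (nsphere 3). of_nsphere c \<in> S3 \<inter> V}"
    by (rule openin_continuous_map_preimage [OF nsphere_maps(2)], rule openin_open_Int, fact)+
  show "topspace (nsphere 3) \<subseteq> {c \<in> topspace (nsphere 3). of_nsphere c \<in> S3 \<inter> U}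
      \<union> {c \<in> topspace (nsphere 3). of_nsphere c \<in> S3 \<inter> V}"
    using assms(4) nsphere_maps(3) by blast
qed (use cont U V in \<open>auto intro!: continuous_map_conjugate\<close>)

section \<open>Degree of a pointwise product\<close>

lemma SU2_one: "mat 1 \<in> carrier SU2"
  using monoid.one_closed [OF group.is_monoid [OF group_SU2]] by (simp add: SU2_def)

lemma SU2_mult_closed: "A \<in> carrier SU2 \<Longrightarrow> B \<in> carrier SU2 \<Longrightarrow> A ** B \<in> carrier SU2"
  using monoid.m_closed [OF group.is_monoid [OF group_SU2], of A B] by (simp add: SU2_def)

text \<open>The two homotopies are multiplied at each time; matrix multiplication is continuous and
  preserves SU(2).\<close>

lemma homotopic_SU2_mult:
  assumes "homotopic_with_canon (\<lambda>_. True) S (carrier SU2) x x'"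
    and "homotopic_with_canon (\<lambda>_. True) S (carrier SU2) y y'"
  shows "homotopic_with_canon (\<lambda>_. True) S (carrier SU2) (\<lambda>u. x u ** y u) (\<lambda>u. x' u ** y' u)"
proof -
  obtain h k where "continuous_map (prod_topology (top_of_set {0..1::real}) (top_of_set S)) (top_of_set (carrier SU2)) h"
    "continuous_map (prod_topology (top_of_set {0..1::real}) (top_of_set S)) (top_of_set (carrier SU2)) k"
    "\<And>u. h (0, u) = x u" "\<And>u. h (1, u) = x' u" "\<And>u. k (0, u) = y u" "\<And>u. k (1, u) = y' u"
    using assms by (auto simp: homotopic_with_def)
  then show ?thesis
    unfolding homotopic_with_def
    by (intro exI [of _ "\<lambda>z. h z ** k z"])
      (auto simp: continuous_map_in_subtopology Pi_iff image_subset_iff intro!: bounded_bilinear.continuous_on [OF bounded_bilinear_matrix_mult] SU2_mult_closed)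
qed

text \<open>Replace \<open>x\<close> and \<open>y\<close> by homotopic maps that are constant, with values \<open>a\<close> and \<open>b\<close>, on two open
  sets covering the sphere. On each of these the pair \<open>x y\<close>, \<open>a b\<close> agrees with the pair \<open>x b\<close>, \<open>a y\<close> up to
  order.\<close>

lemma degree_SU2_mult:
  assumes x: "continuous_on S3 x" "x \<in> S3 \<rightarrow> carrier SU2"
    and y: "continuous_on S3 y" "y \<in> S3 \<rightarrow> carrier SU2"
  shows "degree_SU2 (\<lambda>u. x u ** y u) = degree_SU2 x + degree_SU2 y"
proof -
  define e :: "real^4" where "e = axis 1 1"
  have e: "e \<in> S3" "- e \<in> S3" by (simp_all add: e_def norm_axis_1)
  obtain \<phi> where \<phi>: "homotopic_with_canon (\<lambda>_. True) S3 S3 \<phi> id" "\<And>q. q \<bullet> e \<le> 1/4 \<Longrightarrow> \<phi> q = - e"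
    using sphere_collapse [OF e(1)] by blast
  obtain \<psi> where \<psi>: "homotopic_with_canon (\<lambda>_. True) S3 S3 \<psi> id" "\<And>q. q \<bullet> (- e) \<le> 1/4 \<Longrightarrow> \<psi> q = - (- e)"
    using sphere_collapse [OF e(2)] by blast
  \<comment> \<open>By the choice of the collapses, \<open>x (\<phi> u) = a\<close> where
    \<open>u \<bullet> e \<le> 1/4\<close>, and \<open>y (\<psi> u) = b\<close> where
    \<open>u \<bullet> e \<ge> - 1/4\<close>.\<close>
  define a b where "a = x (- e)" and "b = y e"
  have ab: "a \<in> carrier SU2" "b \<in> carrier SU2"
    using e x y by (auto simp: a_def b_def)
  have hx: "homotopic_with_canon (\<lambda>_. True) S3 (carrier SU2) (x \<circ> \<phi>) x"
    using homotopic_with_compose_continuous_left [OF \<phi>(1) x] by (simp only: comp_id)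
  have hy: "homotopic_with_canon (\<lambda>_. True) S3 (carrier SU2) (y \<circ> \<psi>) y"
    using homotopic_with_compose_continuous_left [OF \<psi>(1) y] by (simp only: comp_id)
  have x': "continuous_on S3 (x \<circ> \<phi>)" "x \<circ> \<phi> \<in> S3 \<rightarrow> carrier SU2"
    using homotopic_with_imp_continuous [OF hx] homotopic_with_imp_funspace1 [OF hx] by auto
  have y': "continuous_on S3 (y \<circ> \<psi>)" "y \<circ> \<psi> \<in> S3 \<rightarrow> carrier SU2"
    using homotopic_with_imp_continuous [OF hy] homotopic_with_imp_funspace1 [OF hy] by auto
  \<comment> \<open>SU(2) is path connected as an image of the sphere, so the constant factors
    \<open>a\<close> and \<open>b\<close> can be deformed to the identity and dropped from the
    degree.\<close>
  have conn: "homotopic_with_canon (\<lambda>_. True) S3 (carrier SU2) (\<lambda>_. A) (\<lambda>_. mat 1)"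
    if A: "A \<in> carrier SU2" for A
  proof -
    have "path_connected S3"
      by (rule path_connected_sphere) simp
    then have "path_connected (carrier SU2)"
      using homeomorphism_quat_matrix by (metis homeomorphism_def path_connected_continuous_image)
    then have "path_component (carrier SU2) A (mat 1)"
      using A SU2_one by (simp add: path_connected_component)
    then show ?thesis
      by (simp add: homotopic_constant_maps)
  qed
  have 1: "degree_SU2 (\<lambda>u. x (\<phi> u) ** y (\<psi> u)) = degree_SU2 (\<lambda>u. x u ** y u)"
    using homotopic_SU2_mult [OF hx hy] by (intro degree_SU2_homotopic) (simp add: o_def)
  have "degree_SU2 (\<lambda>u. x (\<phi> u) ** b) = degree_SU2 (\<lambda>u. x u ** mat 1)"
    using homotopic_SU2_mult [OF hx conn [OF ab(2)]] by (intro degree_SU2_homotopic) (simp add: o_def)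
  then have 2: "degree_SU2 (\<lambda>u. x (\<phi> u) ** b) = degree_SU2 x"
    by simp
  have "degree_SU2 (\<lambda>u. a ** y (\<psi> u)) = degree_SU2 (\<lambda>u. mat 1 ** y u)"
    using homotopic_SU2_mult [OF conn [OF ab(1)] hy] by (intro degree_SU2_homotopic) (simp add: o_def)
  then have 3: "degree_SU2 (\<lambda>u. a ** y (\<psi> u)) = degree_SU2 y"
    by simp
  \<comment> \<open>The pairs agree in order where \<open>y (\<psi> u) = b\<close>, and after an
    exchange where \<open>x (\<phi> u) = a\<close>. The constant product completes the first pair
    and has degree 0.\<close>
  have "degree_SU2 (\<lambda>u. x (\<phi> u) ** y (\<psi> u)) + degree_SU2 (\<lambda>_. a ** b)
      = degree_SU2 (\<lambda>u. x (\<phi> u) ** b) + degree_SU2 (\<lambda>u. a ** y (\<psi> u))"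
  proof (rule degree_SU2_add_eq_if_cover [where U = "{u. u \<bullet> e > - 1/4}" and V = "{u. u \<bullet> e < 1/4}"])
    show "continuous_on S3 f \<and> f \<in> S3 \<rightarrow> carrier SU2"
      if "f \<in> {\<lambda>u. x (\<phi> u) ** y (\<psi> u), \<lambda>_. a ** b, \<lambda>u. x (\<phi> u) ** b, \<lambda>u. a ** y (\<psi> u)}" for f
      using that x' y' ab
      by (auto simp: o_def Pi_iff intro!: bounded_bilinear.continuous_on [OF bounded_bilinear_matrix_mult] SU2_mult_closed)
    show "open {u. u \<bullet> e > - 1/4}" "open {u. u \<bullet> e < 1/4}"
      by (intro open_Collect_less continuous_intros)+
    show "S3 \<subseteq> {u. u \<bullet> e > - 1/4} \<union> {u. u \<bullet> e < 1/4}"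
      by auto
  qed (use \<phi>(2) \<psi>(2) in \<open>auto simp: a_def b_def\<close>)
  then show ?thesis
    using 1 2 3 by (simp add: degree_SU2_const)
qed

section \<open>Smooth maps into SU(2) and signs\<close>

lemma smooth_map_on_continuous_on:
  assumes "smooth_map_on A f"
  shows "continuous_on A f"
proof (rule continuous_on_eq_continuous_within [THEN iffD2, rule_format])
  fix p assume p: "p \<in> A"
  then obtain U g where U: "open U" "p \<in> U" "\<forall>k. C_k_on k U g" "\<forall>q\<in>A \<inter> U. g q = f q"
    using assms unfolding smooth_map_on_def by meson
  have "continuous_on U g"
    using C_k_on_continuous [OF spec [OF U(3)]] .
  then have "continuous_on (A \<inter> U) g"
    by (rule continuous_on_subset) simp
  then have "continuous_on (A \<inter> U) f"
    using U(4) by (auto intro: continuous_on_eq)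
  then have "continuous (at p within A \<inter> U) f"
    using p U(2) by (simp add: continuous_on_eq_continuous_within)
  then show "continuous (at p within A) f"
    using at_within_nhd [OF U(2,1), of "A \<inter> U" A] by auto
qed

lemma smooth_SU2_D:
  assumes "x \<in> carrier smooth_SU2"
  shows "continuous_on S3 x" "x \<in> S3 \<rightarrow> carrier SU2" "smooth_map_on S3 x" "x \<in> extensional S3"
  using assms by (auto simp: smooth_SU2_def PiE_def smooth_map_on_continuous_on)

lemma restrict_in_smooth_SU2:
  assumes "smooth_map_on S3 x" "x \<in> S3 \<rightarrow> carrier SU2"
  shows "restrict x S3 \<in> carrier smooth_SU2"
  using assms smooth_map_on_cong [of S3 "restrict x S3" x] by (auto simp: smooth_SU2_def)

lemma uminus_matrix_mult:
  fixes A B :: "complex^2^2"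
  shows "(- A) ** B = - (A ** B)" "A ** (- B) = - (A ** B)"
  using bounded_bilinear.minus_left [OF bounded_bilinear_matrix_mult]
    bounded_bilinear.minus_right [OF bounded_bilinear_matrix_mult] by auto

lemma SU2_uminus: "A \<in> carrier SU2 \<Longrightarrow> - A \<in> carrier SU2"
  by (simp add: SU2_iff)

text \<open>Since \<open>- mat 1\<close> squares to the identity, only the parity of the exponent
  counts, also for negative \<open>n\<close>.\<close>

lemma minus_one_int_pow:
  "(- mat 1) [^]\<^bsub>SU2\<^esub> (n::int) = (if even n then mat 1 else - mat 1)"
proof -
  interpret SU2: group SU2 by (rule group_SU2)
  have one: "\<one>\<^bsub>SU2\<^esub> = mat 1" and mult: "(\<otimes>\<^bsub>SU2\<^esub>) = (**)"
    by (simp_all add: SU2_def)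
  have m1: "- mat 1 \<in> carrier SU2"
    by (rule SU2_uminus [OF SU2_one])
  have sq: "(- mat 1) [^]\<^bsub>SU2\<^esub> (2 * k :: int) = mat 1" for k
  proof -
    have "(- mat 1) [^]\<^bsub>SU2\<^esub> (2::int) = (- mat 1) ** (- mat 1)"
      using SU2.int_pow_mult [OF m1, of 1 1] m1 by (simp add: mult)
    also have "\<dots> = \<one>\<^bsub>SU2\<^esub>"
      by (simp add: one uminus_matrix_mult)
    finally show ?thesis
      using SU2.int_pow_pow [OF m1, of 2 k] by (simp add: one [symmetric])
  qed
  show ?thesis
  proof (cases "even n")
    case True
    then show ?thesis using sq by (elim evenE) simp
  next
    case False
    then obtain k where "n = 2 * k + 1" by (elim oddE)
    then show ?thesis
      using SU2.int_pow_mult [OF m1, of "2 * k" 1] m1 sq [of k] by (simp add: mult)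
  qed
qed

section \<open>The map \<open>f0\<close> and its evaluations\<close>

lemma f0_apply:
  "u \<in> S3 \<Longrightarrow> f0 x u = (if even (degree_SU2 x) then x u else - x u)"
  by (simp only: f0_def minus_one_int_pow) (simp add: SU2_def uminus_matrix_mult)

lemma f0_closed:
  assumes x: "x \<in> carrier smooth_SU2"
  shows "f0 x \<in> carrier smooth_SU2"
proof -
  define y where "y u = (if even (degree_SU2 x) then x u else - x u)" for u
  have "smooth_map_on S3 y"
    using smooth_SU2_D(3) [OF x] smooth_map_on_linear [OF bounded_linear_minus [OF bounded_linear_ident], of S3 x]
    unfolding y_def by (cases "even (degree_SU2 x)") simp_all
  then have "restrict y S3 \<in> carrier smooth_SU2"
    using smooth_SU2_D(2) [OF x] by (intro restrict_in_smooth_SU2) (auto simp: y_def SU2_uminus Pi_iff)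
  moreover have "f0 x = restrict y S3"
    by (rule ext) (auto simp: f0_apply y_def, simp add: f0_def)
  ultimately show ?thesis
    by simp
qed

text \<open>A sign change is the product with a constant map, which has degree 0.\<close>

lemma degree_SU2_f0:
  assumes x: "x \<in> carrier smooth_SU2"
  shows "degree_SU2 (f0 x) = degree_SU2 x"
proof (cases "even (degree_SU2 x)")
  case True
  then show ?thesis
    by (intro degree_SU2_cong) (simp add: f0_apply)
next
  case False
  have "degree_SU2 (f0 x) = degree_SU2 (\<lambda>u. (- mat 1) ** x u)"
    using False by (intro degree_SU2_cong) (simp add: f0_apply uminus_matrix_mult)
  also have "\<dots> = degree_SU2 (\<lambda>_. - mat 1) + degree_SU2 x"
    using smooth_SU2_D(1,2) [OF x] SU2_uminus [OF SU2_one] by (intro degree_SU2_mult) auto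
  finally show ?thesis
    by (simp add: degree_SU2_const)
qed

text \<open>Degrees add under products, so the parities combine like the signs; the signs are
  central and can be pulled out of the matrix product.\<close>

lemma f0_hom: "f0 \<in> hom smooth_SU2 smooth_SU2"
proof (rule homI)
  fix x y assume xy: "x \<in> carrier smooth_SU2" "y \<in> carrier smooth_SU2"
  have mult: "x \<otimes>\<^bsub>smooth_SU2\<^esub> y = (\<lambda>u\<in>S3. x u ** y u)" for x y
    by (simp add: smooth_SU2_def SU2_def)
  have "degree_SU2 (\<lambda>u\<in>S3. x u ** y u) = degree_SU2 (\<lambda>u. x u ** y u)"
    by (intro degree_SU2_cong) simp
  then have deg: "degree_SU2 (\<lambda>u\<in>S3. x u ** y u) = degree_SU2 x + degree_SU2 y"
    using xy by (simp add: degree_SU2_mult smooth_SU2_D)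
  show "f0 (x \<otimes>\<^bsub>smooth_SU2\<^esub> y) = f0 x \<otimes>\<^bsub>smooth_SU2\<^esub> f0 y"
  proof
    fix u
    show "f0 (x \<otimes>\<^bsub>smooth_SU2\<^esub> y) u = (f0 x \<otimes>\<^bsub>smooth_SU2\<^esub> f0 y) u"
    proof (cases "u \<in> S3")
      case True
      then show ?thesis
        unfolding mult f0_apply [OF True] deg by (auto simp: f0_apply uminus_matrix_mult)
    next
      case False
      then show ?thesis
        unfolding mult by (simp add: f0_def)
    qed
  qed
qed (rule f0_closed)

text \<open>As the degree is unchanged, the same sign is applied twice and cancels. Off the sphere
  both sides are \<open>undefined\<close>.\<close>

lemma f0_f0:
  assumes x: "x \<in> carrier smooth_SU2"
  shows "f0 (f0 x) = x"
proof
  fix u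
  show "f0 (f0 x) u = x u"
  proof (cases "u \<in> S3")
    case True
    then show ?thesis
      by (simp add: f0_apply degree_SU2_f0 [OF x])
  next
    case False
    then show ?thesis
      using smooth_SU2_D(4) [OF x] by (simp add: f0_def extensional_def)
  qed
qed

lemma f0_iso: "f0 \<in> iso smooth_SU2 smooth_SU2"
  using f0_hom f0_closed f0_f0
  by (auto simp: iso_def intro!: bij_betw_byWitness [where f' = f0])

lemma hom_evaluation: "v \<in> S3 \<Longrightarrow> evaluation v \<in> hom smooth_SU2 SU2"
  by (rule homI) (auto simp: evaluation_def smooth_SU2_def)

text \<open>For even degree the value is \<open>x v\<close> itself; for odd degree \<open>x\<close>
  is onto SU(2), so \<open>- x v\<close> is attained at some point.\<close>

lemma range_decreasing_evaluation_f0: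
  assumes v: "v \<in> S3"
  shows "range_decreasing (evaluation v \<circ> f0)"
  unfolding range_decreasing_def
proof
  fix x assume x: "x \<in> carrier smooth_SU2"
  show "(evaluation v \<circ> f0) x \<in> x ` S3"
  proof (cases "even (degree_SU2 x)")
    case True
    then show ?thesis
      using v by (simp add: evaluation_def f0_apply)
  next
    case False
    then have "degree_SU2 x \<noteq> 0"
      by auto
    moreover have "- x v \<in> carrier SU2"
      using smooth_SU2_D(2) [OF x] v by (intro SU2_uminus) auto
    ultimately have "- x v \<in> x ` S3"
      using degree_SU2_eq_0_if_not_surj smooth_SU2_D(1,2) [OF x] by blast
    then show ?thesis
      using False v by (simp add: evaluation_def f0_apply)
  qed
qed

section \<open>Two test maps that rule out evaluations\<close>

text \<open>Cosine and sine are treated in one induction because differentiation exchanges them up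
  to sign and a constant factor.\<close>

lemma C_k_on_cos_sin_inner:
  fixes v :: "'a::euclidean_space"
  shows "C_k_on k UNIV (\<lambda>q. cos (q \<bullet> v)) \<and> C_k_on k UNIV (\<lambda>q. sin (q \<bullet> v))"
proof (induction k)
  case 0
  show ?case by (auto intro!: continuous_intros)
next
  case (Suc k)
  have "C_k_on k UNIV (\<lambda>q. - (w \<bullet> v) * sin (q \<bullet> v))" "C_k_on k UNIV (\<lambda>q. (w \<bullet> v) * cos (q \<bullet> v))" for w
    by (intro C_k_on_bilinear [OF bounded_bilinear_mult] C_k_on_const conjunct1 [OF Suc] conjunct2 [OF Suc] open_UNIV)+
  then show ?case
    by (intro conjI C_k_on_SucI [where f' = "\<lambda>q w. - (w \<bullet> v) * sin (q \<bullet> v)"]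
        C_k_on_SucI [where f' = "\<lambda>q w. (w \<bullet> v) * cos (q \<bullet> v)"])
      (auto intro!: derivative_eq_intros)
qed

lemma bounded_linear_quat_matrix: "bounded_linear quat_matrix"
  unfolding linear_conv_bounded_linear [symmetric]
  by (auto intro!: linearI simp: mat2_eq_iff quat_matrix_def Let_def complex_eq_iff)

lemma quat_matrix_in_SU2: "q \<in> S3 \<Longrightarrow> quat_matrix q \<in> carrier SU2"
  using homeomorphism_quat_matrix by (auto simp: homeomorphism_def)

lemma quat_matrix_inj: "p \<in> S3 \<Longrightarrow> q \<in> S3 \<Longrightarrow> quat_matrix p = quat_matrix q \<Longrightarrow> p = q"
  using homeomorphism_quat_matrix by (metis homeomorphism_def)

lemma smooth_map_on_id: "smooth_map_on A (\<lambda>q. q)"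
proof -
  have "C_k_on k UNIV (\<lambda>q::'a. q)" for k
  proof (cases k)
    case (Suc j)
    show ?thesis
      unfolding Suc by (rule C_k_on_SucI [where f' = "\<lambda>_ w. w"]) (auto intro: C_k_on_const)
  qed simp
  then show ?thesis
    unfolding smooth_map_on_def by (intro ballI exI [of _ UNIV] exI [of _ "\<lambda>q. q"]) auto
qed

lemma smooth_SU2_identity:
  "restrict quat_matrix S3 \<in> carrier smooth_SU2"
  using smooth_map_on_linear [OF bounded_linear_quat_matrix smooth_map_on_id]
  by (intro restrict_in_smooth_SU2) (auto intro: quat_matrix_in_SU2)

text \<open>The unit quaternion exp (i t), on the great circle through 1 and i.\<close>

definition circle_quat :: "real \<Rightarrow> real^4" where
  "circle_quat t = cos t *\<^sub>R axis 1 1 + sin t *\<^sub>R axis 2 1"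

lemma circle_quat_nth:
  "circle_quat t $ 1 = cos t" "circle_quat t $ 2 = sin t" "circle_quat t $ 3 = 0" "circle_quat t $ 4 = 0"
  by (simp_all add: circle_quat_def axis_def)

lemma circle_quat_in_S3: "circle_quat t \<in> S3"
  by (simp add: norm4_eq_1_iff circle_quat_nth)

lemma smooth_SU2_circle:
  "(\<lambda>q\<in>S3. quat_matrix (circle_quat (q \<bullet> v))) \<in> carrier smooth_SU2"
proof (rule restrict_in_smooth_SU2)
  have "C_k_on k UNIV (\<lambda>q. circle_quat (q \<bullet> v))" for k
    unfolding circle_quat_def using C_k_on_cos_sin_inner [of k v]
    by (intro C_k_on_add C_k_on_bilinear [OF bounded_bilinear_scaleR] C_k_on_const) auto
  then have "smooth_map_on S3 (\<lambda>q. circle_quat (q \<bullet> v))"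
    unfolding smooth_map_on_def by (intro ballI exI [of _ UNIV] exI [of _ "\<lambda>q. circle_quat (q \<bullet> v)"]) auto
  then show "smooth_map_on S3 (\<lambda>q. quat_matrix (circle_quat (q \<bullet> v)))"
    by (rule smooth_map_on_linear [OF bounded_linear_quat_matrix])
qed (use quat_matrix_in_SU2 [OF circle_quat_in_S3] in auto)

text \<open>The image lies in the plane of 1 and i, so the quaternion j, which is
  \<open>axis 3 1\<close>, is missed.\<close>

lemma degree_SU2_circle: "degree_SU2 (\<lambda>q\<in>S3. quat_matrix (circle_quat (q \<bullet> v))) = 0"
proof (rule degree_SU2_eq_0_if_not_surj)
  have e: "axis 3 1 \<in> S3"
    by (simp add: norm_axis_1)
  show "quat_matrix (axis 3 1) \<in> carrier SU2"
    by (rule quat_matrix_in_SU2 [OF e])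
  have "axis 3 1 \<noteq> circle_quat t" for t
    by (simp add: vec4_eq_iff circle_quat_nth axis_def)
  then show "quat_matrix (axis 3 1) \<notin> (\<lambda>q\<in>S3. quat_matrix (circle_quat (q \<bullet> v))) ` S3"
    using quat_matrix_inj [OF e circle_quat_in_S3] by auto
qed (use smooth_SU2_D [OF smooth_SU2_circle] in auto)

lemma evaluation_f0_not_evaluation:
  assumes v: "v \<in> S3" and u: "u \<in> S3"
    and eq: "\<And>x. x \<in> carrier smooth_SU2 \<Longrightarrow> (evaluation v \<circ> f0) x = evaluation u x"
  shows False
proof -
  \<comment> \<open>The identity map has odd degree, so the sign appears and \<open>u\<close> must
    be the antipode of \<open>v\<close>.\<close>
  have "degree_SU2 (restrict quat_matrix S3) = 1"
    using degree_SU2_cong [of "restrict quat_matrix S3" quat_matrix] by (simp add: degree_SU2_quat_matrix)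
  then have "quat_matrix u = - quat_matrix v"
    using eq [OF smooth_SU2_identity] u v by (simp add: evaluation_def f0_apply)
  then have "quat_matrix u = quat_matrix (- v)"
    by (simp add: linear_neg bounded_linear.linear [OF bounded_linear_quat_matrix])
  then have "u = - v"
    using quat_matrix_inj [OF u, of "- v"] v by simp
  \<comment> \<open>At degree 0 no sign appears, so the circle map must take equal values at
    \<open>v\<close> and \<open>u\<close>.\<close>
  moreover have "quat_matrix (circle_quat (v \<bullet> v)) = quat_matrix (circle_quat (u \<bullet> v))"
    using eq [OF smooth_SU2_circle [of v]] u v by (simp add: evaluation_def f0_apply degree_SU2_circle)
  then have "circle_quat (v \<bullet> v) = circle_quat (u \<bullet> v)"
    by (rule quat_matrix_inj [OF circle_quat_in_S3 circle_quat_in_S3])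
  then have "sin (v \<bullet> v) = sin (u \<bullet> v)"
    by (metis circle_quat_nth(2))
  moreover have "v \<bullet> v = 1"
    using v by (simp add: dot_square_norm)
  \<comment> \<open>With \<open>u = - v\<close> the inner products are 1 and -1, and oddness gives
    \<open>sin 1 = - sin 1\<close>; this is impossible as 0 < 1 < pi.\<close>
  ultimately have "sin (1::real) = 0"
    by simp
  then show False
    using sin_gt_zero [of 1] pi_gt3 by simp
qed

theorem proposition4p2:
  shows "f0 \<in> iso smooth_SU2 smooth_SU2 \<and>
    (\<forall>v\<in>S3.
       evaluation v \<circ> f0 \<in> hom smooth_SU2 SU2 \<and>
       range_decreasing (evaluation v \<circ> f0) \<and>
       \<not> (\<exists>u\<in>S3. \<forall>x\<in>carrier smooth_SU2. (evaluation v \<circ> f0) x = evaluation u x))"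
  using f0_iso hom_compose [OF f0_hom hom_evaluation] range_decreasing_evaluation_f0
    evaluation_f0_not_evaluation by blast

end
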